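(* Fix $n\geq 1$ and an arbitrary family of $m\ge 0$ valid linear cuts $\ell_1,\dots,\ell_m$ in dimension $n$, and let $$\mathcal{R}_n=\{(x,X)\in\mathcal{S}_n:\ \ell_j(x,X)\ge 0\ \ \forall j=1,\dots,m\}.$$ Then the SDP relaxation with cuts $\ell_1,\dots,\ell_m$ is tight for the submodular BCQP over all instances $(Q,c)\in\mathcal{N}_\infty^n$ if and only if $\mathcal{R}_n\subseteq\mathcal{M}_n+\mathcal{D}_n$ (Minkowski sum).
   Context: $\mathbb{S}^n$ is the space of real symmetric $n\times n$ matrices and $Q\bullet X=\sum_{i,j}Q_{ij}X_{ij}$. The submodular box-constrained quadratic program (BCQP) for $(Q,c)$ with $Q_{ij}\le0$ for $i\neq j$ is $\min\{x^\top Qx+c^\top x: x\in[0,1]^n\}$. The set of normalized instances is $$\mathcal{N}_\infty^n=\{(Q,c)\in\mathbb{S}^n\times\mathbb{R}^n:\ \max_{i,j}|Q_{ij}|\le 1,\ \|c\|_\infty\le 1,\ Q_{ij}\le 0\ \forall i\neq j\}.$$ Let $$\mathcal{S}_n=\Big\{(x,X)\in\mathbb{R}^n\times\mathbb{S}^n:\begin{pmatrix} 1 & x^\top \\ x & X \end{pmatrix}\succeq0\Big\},\qquad \mathcal{M}_n=\mathrm{conv}\{(x,xx^\top):x\in[0,1]^n\},$$ $$\mathcal{D}_n=\{(0,H)\in\mathbb{R}^n\times\mathbb{S}^n:\ H_{ii}=0\ \forall i,\ H_{ij}\le 0\ \forall i\ne j\}.$$ A valid linear cut is an inequality $\ell(x,X)\ge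 0$ with $\ell(x,X)=c_0+\sum_i b_ix_i+\sum_i d_iX_{ii}+\sum_{1\le i<j\le n}h_{ij}X_{ij}$ such that $\ell(x,xx^\top)\ge 0$ for all $x\in[0,1]^n$. The SDP relaxation is $\min\{Q\bullet X+c^\top x:(x,X)\in\mathcal{R}_n\}$ (value understood as an infimum in $\mathbb{R}\cup\{-\infty\}$); it is tight for $(Q,c)$ if its optimal value equals the BCQP optimal value. *)

theory Defs
  imports "HOL-Analysis.Analysis"
begin

text \<open>
  The dimension is \<open>n = CARD('n)\<close>. A pair \<open>(x, X)\<close> has type
  \<open>'n pair_space\<close>; membership in the space of symmetric matrices is always
  stated explicitly. The library inner product on \<open>real^'n^'n\<close> is the entrywise one,
  i.e. \<open>Q \<bullet> X = (\<Sum>i\<in>UNIV. \<Sum>j\<in>UNIV. Q$i$j * X$i$j)\<close>.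
\<close>

type_synonym 'n pair_space = "(real, 'n) vec \<times> ((real, 'n) vec, 'n) vec"

definition symmetric_mat :: "real^'n^'n \<Rightarrow> bool" where
  "symmetric_mat A \<longleftrightarrow> transpose A = A"

definition psd :: "real^'n^'n \<Rightarrow> bool" where
  "psd A \<longleftrightarrow> symmetric_mat A \<and> (\<forall>v. 0 \<le> v \<bullet> (A *v v))"

definition outer :: "real^'n \<Rightarrow> real^'n^'n" where
  "outer x = (\<chi> i j. x$i * x$j)"

definition unit_box :: "(real^'n) set" where
  "unit_box = {x. \<forall>i. 0 \<le> x$i \<and> x$i \<le> 1}"

text \<open>The bordered matrix is indexed by \<open>'n option\<close>, with \<open>None\<close> as the additional index.\<close>

definition bordered :: "real^'n \<Rightarrow> real^'n^'n \<Rightarrow> real^('n option)^('n option)" where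
  "bordered x X = (\<chi> p q. case (p, q) of
       (None, None) \<Rightarrow> 1
     | (None, Some j) \<Rightarrow> x$j
     | (Some i, None) \<Rightarrow> x$i
     | (Some i, Some j) \<Rightarrow> X$i$j)"

definition normalized_instances :: "((real^'n^'n) \<times> (real^'n)) set" where
  "normalized_instances = {(Q, c). symmetric_mat Q \<and> (\<forall>i j. \<bar>Q$i$j\<bar> \<le> 1) \<and> infnorm c \<le> 1 \<and>
     (\<forall>i j. i \<noteq> j \<longrightarrow> Q$i$j \<le> 0)}"

definition sdp_set :: "'n::finite pair_space set" where
  "sdp_set = {(x, X). symmetric_mat X \<and> psd (bordered x X)}"

definition moment_hull :: "'n::finite pair_space set" where
  "moment_hull = convex hull {(x, outer x) | x. x \<in> unit_box}"

definition offdiag_nonpos :: "'n::finite pair_space set" where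
  "offdiag_nonpos = {(0, H) | H. symmetric_mat H \<and> (\<forall>i. H$i$i = 0) \<and>
     (\<forall>i j. i \<noteq> j \<longrightarrow> H$i$j \<le> 0)}"

text \<open>
  The linear order on the index type only serves to write the sum over pairs \<open>i < j\<close>; every
  \<open>n \<ge> 1\<close> is the cardinality of such a type.
\<close>

definition cut_fun ::
    "real \<Rightarrow> (real, 'n) vec \<Rightarrow> (real, 'n) vec \<Rightarrow> ((real, 'n) vec, 'n) vec \<Rightarrow>
      'n::{finite,linorder} pair_space \<Rightarrow> real" where
  "cut_fun c0 b d h = (\<lambda>(x, X). c0 + (\<Sum>i\<in>UNIV. b$i * x$i) + (\<Sum>i\<in>UNIV. d$i * X$i$i)
     + (\<Sum>(i, j) | i < j. h$i$j * X$i$j))"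

definition valid_cut :: "('n::{finite,linorder} pair_space \<Rightarrow> real) \<Rightarrow> bool" where
  "valid_cut l \<longleftrightarrow> (\<exists>c0 b d h. l = cut_fun c0 b d h) \<and> (\<forall>x\<in>unit_box. 0 \<le> l (x, outer x))"

definition relaxation ::
    "nat \<Rightarrow> (nat \<Rightarrow> 'n pair_space \<Rightarrow> real) \<Rightarrow> 'n::finite pair_space set" where
  "relaxation m l = {p \<in> sdp_set. \<forall>j\<in>{1..m}. 0 \<le> l j p}"

text \<open>
  Optimal values are infima in \<open>ereal\<close>. The first is a minimum, since the box is compact; the
  second may be \<open>-\<infinity>\<close>.
\<close>

definition bcqp_value :: "real^'n^'n \<Rightarrow> real^'n \<Rightarrow> ereal" where
  "bcqp_value Q c = (INF x\<in>unit_box. ereal (x \<bullet> (Q *v x) + c \<bullet> x))"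

definition sdp_value :: "'n pair_space set \<Rightarrow> real^'n^'n \<Rightarrow> real^'n \<Rightarrow> ereal" where
  "sdp_value R Q c = (INF (x, X)\<in>R. ereal (Q \<bullet> X + c \<bullet> x))"

definition tight_for :: "'n pair_space set \<Rightarrow> real^'n^'n \<Rightarrow> real^'n \<Rightarrow> bool" where
  "tight_for R Q c \<longleftrightarrow> sdp_value R Q c = bcqp_value Q c"

end

theory Submission
  imports Defs
begin

text \<open>
  The objective \<open>Q \<bullet> X + c \<bullet> x\<close> is a linear functional on pairs \<open>(x, X)\<close>, and the box problem
  minimizes it over the points \<open>(x, outer x)\<close>, equivalently over their convex hull. All these
  points lie in the relaxation, so tightness for \<open>(Q, c)\<close> means that the functional does not drop
  below the box value anywhere on the relaxation (\<open>tight_for_iff\<close>). The submodular objectives are,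
  among the functionals given by a symmetric \<open>Q\<close>, exactly those that are nonnegative on the cone
  \<open>offdiag_nonpos\<close>; hence adding that cone to the moment hull does not lower the minimum, which
  gives the implication from the inclusion to tightness.

  Conversely, \<open>moment_hull + offdiag_nonpos\<close> is closed and convex, being the sum of a compact
  convex set and a closed convex cone. A point of the relaxation outside it would be strictly
  separated from it by some functional. Since that functional is bounded below on a cone, it is
  nonnegative there; after replacing \<open>Q\<close> by its symmetric part, which changes nothing on symmetric
  matrices, it is a submodular objective, and a positive multiple of it is a normalized instance
  for which the relaxation is not tight (\<open>separating_normalized_instance\<close>).
\<close>

section \<open>Objectives and the moment hull\<close>

lemma quadratic_form_eq_inner_outer:
  fixes Q :: "real^'n^'n"
  shows "x \<bullet> (Q *v x) = Q \<bullet> outer x"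
  by (simp add: inner_vec_def outer_def matrix_vector_mult_def sum_distrib_left algebra_simps)

lemma inner_transpose_left:
  fixes A B :: "real^'n^'n"
  shows "transpose A \<bullet> B = A \<bullet> transpose B"
  unfolding inner_vec_def transpose_def by (simp, rule sum.swap)

lemma psd_outer: "psd (outer z)"
proof -
  have "v \<bullet> (outer z *v v) = (z \<bullet> v)\<^sup>2" for v
    unfolding quadratic_form_eq_inner_outer
    by (simp add: inner_vec_def outer_def power2_eq_square sum_product algebra_simps)
  then show ?thesis
    by (simp add: psd_def symmetric_mat_def outer_def transpose_def vec_eq_iff mult.commute)
qed

text \<open>Bordering a rank-one lift gives the rank-one lift of \<open>x\<close> extended by a coordinate \<open>1\<close>, so
  the semidefinite constraint holds at every \<open>(x, outer x)\<close>.\<close>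

lemma bordered_outer:
  "bordered x (outer x) = outer (\<chi> p. case p of None \<Rightarrow> 1 | Some i \<Rightarrow> x$i)"
  by (simp add: bordered_def outer_def vec_eq_iff split: option.split)

lemma outer_in_sdp_set: "(x, outer x) \<in> sdp_set"
  using psd_outer[of x] psd_outer[of "\<chi> p. case p of None \<Rightarrow> 1 | Some i \<Rightarrow> x$i"]
  by (simp add: sdp_set_def bordered_outer psd_def)

lemma outer_in_moment_hull: "x \<in> unit_box \<Longrightarrow> (x, outer x) \<in> moment_hull"
  unfolding moment_hull_def by (rule hull_inc) auto

lemma zero_in_moment_hull: "0 \<in> moment_hull"
proof -
  have "0 \<in> unit_box" "outer 0 = 0"
    by (simp_all add: unit_box_def outer_def vec_eq_iff)
  then show ?thesis
    using outer_in_moment_hull by (metis zero_prod_def)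
qed

lemma compact_moment_hull: "compact (moment_hull :: 'n::finite pair_space set)"
proof -
  have box: "(unit_box :: (real^'n) set) = cbox 0 1"
    by (auto simp: unit_box_def mem_box_cart)
  have "continuous_on unit_box (\<lambda>x :: real^'n. (x, outer x))"
    unfolding outer_def by (intro continuous_intros)
  then have "compact ((\<lambda>x :: real^'n. (x, outer x)) ` unit_box)"
    by (rule compact_continuous_image) (simp add: box compact_cbox)
  moreover have "(\<lambda>x :: real^'n. (x, outer x)) ` unit_box = {(x, outer x) | x. x \<in> unit_box}"
    by auto
  ultimately show ?thesis
    unfolding moment_hull_def by (simp add: compact_convex_hull)
qed

text \<open>If every generator had a larger value than a point of the hull, then the hull would lie in
  an open half-space that omits this point.\<close>

lemma convex_hull_generator_le:
  fixes a :: "'a::real_inner"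
  assumes "p \<in> convex hull S"
  obtains q where "q \<in> S" "a \<bullet> q \<le> a \<bullet> p"
proof (cases "S \<subseteq> {z. a \<bullet> z > a \<bullet> p}")
  case True
  then have "convex hull S \<subseteq> {z. a \<bullet> z > a \<bullet> p}"
    by (rule hull_minimal) (rule convex_halfspace_gt)
  with assms show ?thesis by auto
next
  case False
  then show ?thesis using that by force
qed

lemma bcqp_value_le_on_moment_hull:
  assumes "(x, X) \<in> moment_hull"
  shows "bcqp_value Q c \<le> ereal (Q \<bullet> X + c \<bullet> x)"
proof -
  obtain q where "q \<in> {(y, outer y) | y. y \<in> unit_box}" "(c, Q) \<bullet> q \<le> (c, Q) \<bullet> (x, X)"
    using convex_hull_generator_le assms unfolding moment_hull_def by blast
  then obtain y where y: "y \<in> unit_box" "Q \<bullet> outer y + c \<bullet> y \<le> Q \<bullet> X + c \<bullet> x"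
    by (auto simp: inner_prod_def algebra_simps)
  have "bcqp_value Q c \<le> ereal (y \<bullet> (Q *v y) + c \<bullet> y)"
    unfolding bcqp_value_def using y(1) by (rule INF_lower)
  also have "\<dots> \<le> ereal (Q \<bullet> X + c \<bullet> x)"
    using y(2) by (simp add: quadratic_form_eq_inner_outer)
  finally show ?thesis .
qed

section \<open>Tightness as a lower bound on the relaxation\<close>

lemma tight_for_iff:
  assumes "\<And>x. x \<in> unit_box \<Longrightarrow> (x, outer x) \<in> R"
  shows "tight_for R Q c \<longleftrightarrow> (\<forall>(x, X)\<in>R. bcqp_value Q c \<le> ereal (Q \<bullet> X + c \<bullet> x))"
proof -
  have "sdp_value R Q c \<le> bcqp_value Q c"
    unfolding bcqp_value_def sdp_value_def
  proof (rule INF_greatest)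
    fix x :: "real^'a" assume "x \<in> unit_box"
    from INF_lower[OF assms[OF this], of "\<lambda>(x, X). ereal (Q \<bullet> X + c \<bullet> x)"]
    show "(INF (x, X)\<in>R. ereal (Q \<bullet> X + c \<bullet> x)) \<le> ereal (x \<bullet> (Q *v x) + c \<bullet> x)"
      by (simp add: quadratic_form_eq_inner_outer)
  qed
  then have "tight_for R Q c \<longleftrightarrow> bcqp_value Q c \<le> sdp_value R Q c"
    unfolding tight_for_def by auto
  also have "\<dots> \<longleftrightarrow> (\<forall>(x, X)\<in>R. bcqp_value Q c \<le> ereal (Q \<bullet> X + c \<bullet> x))"
    unfolding sdp_value_def le_INF_iff by (simp add: case_prod_beta)
  finally show ?thesis .
qed

lemma outer_in_relaxation:
  assumes "\<forall>j\<in>{1..m}. valid_cut (l j)" "x \<in> unit_box"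
  shows "(x, outer x) \<in> relaxation m l"
  using assms outer_in_sdp_set by (auto simp: relaxation_def valid_cut_def)

section \<open>The cone of off-diagonal nonpositive matrices\<close>

lemma offdiag_nonpos_eq:
  "offdiag_nonpos = {0} \<times> ((\<Inter>i. \<Inter>j. {H. H$i$j = H$j$i}) \<inter> (\<Inter>i. {H. H$i$i = 0}) \<inter>
     (\<Inter>i. \<Inter>j. {H. H$i$j \<le> 0}))"
  unfolding offdiag_nonpos_def symmetric_mat_def transpose_def
  by (auto simp: vec_eq_iff) (metis order_refl)

lemma closed_offdiag_nonpos: "closed (offdiag_nonpos :: 'n::finite pair_space set)"
  unfolding offdiag_nonpos_eq
  by (intro closed_Times closed_Int closed_INT ballI closed_Collect_eq closed_Collect_le
      continuous_intros closed_singleton)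

lemma convex_offdiag_nonpos: "convex (offdiag_nonpos :: 'n::finite pair_space set)"
  unfolding offdiag_nonpos_eq convex_def
  by (auto simp: add_nonpos_nonpos mult_nonneg_nonpos)

lemma scaleR_offdiag_nonpos: "p \<in> offdiag_nonpos \<Longrightarrow> 0 \<le> t \<Longrightarrow> t *\<^sub>R p \<in> offdiag_nonpos"
  unfolding offdiag_nonpos_eq by (auto simp: mult_nonneg_nonpos)

lemma closed_convex_moment_hull_plus:
  "closed (moment_hull + offdiag_nonpos :: 'n::finite pair_space set)"
  "convex (moment_hull + offdiag_nonpos :: 'n::finite pair_space set)"
proof -
  show "closed (moment_hull + offdiag_nonpos :: 'n pair_space set)"
  proof -
    have "moment_hull + offdiag_nonpos =
        (\<Union>p \<in> moment_hull. \<Union>d \<in> (offdiag_nonpos :: 'n pair_space set). {p + d})"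
      by (auto simp: set_plus_def)
    then show ?thesis
      using compact_closed_sums[OF compact_moment_hull closed_offdiag_nonpos] by simp
  qed
  show "convex (moment_hull + offdiag_nonpos :: 'n pair_space set)"
    by (intro convex_set_plus convex_offdiag_nonpos) (simp add: moment_hull_def)
qed

text \<open>A separating functional need not come from a symmetric matrix. Symmetry of the points lets
  its matrix be replaced by the symmetric part.\<close>

lemma symmetric_of_moment_hull_plus:
  assumes "(x, X) \<in> moment_hull + offdiag_nonpos"
  shows "transpose X = X"
proof -
  obtain Y H where X: "X = Y + H" and Y: "(x, Y) \<in> moment_hull" and H: "transpose H = H"
    using assms by (auto simp: set_plus_def offdiag_nonpos_def symmetric_mat_def)
  have conv: "convex {z :: 'a pair_space. transpose (snd z) = snd z}"
    by (auto simp: convex_def transpose_def vec_eq_iff)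
  have "moment_hull \<subseteq> {z :: 'a pair_space. transpose (snd z) = snd z}"
    unfolding moment_hull_def
    by (rule hull_minimal[where S=convex, OF _ conv])
       (auto simp: outer_def transpose_def vec_eq_iff)
  with Y have "transpose Y = Y" by auto
  with X H show ?thesis by (simp add: transpose_def vec_eq_iff)
qed

lemma inner_offdiag_nonpos_ge_0:
  fixes Q H :: "real^'n^'n"
  assumes "\<forall>i j. i \<noteq> j \<longrightarrow> Q$i$j \<le> 0" "(x, H) \<in> offdiag_nonpos"
  shows "0 \<le> Q \<bullet> H"
proof -
  have "0 \<le> Q$i$j * H$i$j" for i j
    using assms by (cases "i = j") (auto simp: offdiag_nonpos_def mult_nonpos_nonpos)
  then show ?thesis by (simp add: inner_vec_def sum_nonneg)
qed

text \<open>The cone is generated by the matrices whose only nonzero entries are \<open>-1\<close> at the positions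
  \<open>(i, j)\<close> and \<open>(j, i)\<close>; testing against them recovers the sign of each entry.\<close>

lemma nonpos_if_inner_offdiag_nonpos_ge_0:
  fixes Q :: "real^'n^'n"
  assumes sym: "transpose Q = Q" and nn: "\<And>H. (0, H) \<in> offdiag_nonpos \<Longrightarrow> 0 \<le> Q \<bullet> H"
    and "i \<noteq> j"
  shows "Q$i$j \<le> 0"
proof -
  define H :: "real^'n^'n" where "H = - (axis i (axis j 1) + axis j (axis i 1))"
  have "(0, H) \<in> offdiag_nonpos"
    using \<open>i \<noteq> j\<close>
    by (auto simp: offdiag_nonpos_eq H_def axis_def)
  then have "0 \<le> Q \<bullet> H" by (rule nn)
  also have "Q \<bullet> H = - (Q$i$j + Q$j$i)"
    by (simp add: H_def inner_axis inner_diff_right)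
  also have "Q$j$i = Q$i$j"
    using sym by (metis transpose_def vec_lambda_beta)
  finally show ?thesis by simp
qed

section \<open>Separation by a normalized instance\<close>

text \<open>Along a ray on which \<open>a\<close> is negative, the value \<open>b\<close> itself would be attained, at the
  multiple \<open>b / (a \<bullet> h)\<close> of \<open>h\<close>.\<close>

lemma cone_bounded_below_nonneg:
  fixes a :: "'a::real_inner"
  assumes cone: "\<And>t. 0 \<le> t \<Longrightarrow> t *\<^sub>R h \<in> C" and bound: "\<And>z. z \<in> C \<Longrightarrow> b < a \<bullet> z"
  shows "0 \<le> a \<bullet> h"
proof (rule ccontr)
  assume neg: "\<not> 0 \<le> a \<bullet> h"
  have "b < 0" using bound[OF cone[of 0]] by simp
  with neg have "0 \<le> b / (a \<bullet> h)" by (simp add: divide_nonpos_neg)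
  from bound[OF cone[OF this]] neg show False by simp
qed

lemma separating_normalized_instance:
  fixes X :: "real^'n^'n"
  assumes sym: "transpose X = X" and out: "(x, X) \<notin> moment_hull + offdiag_nonpos"
  obtains Q c b where "(Q, c) \<in> normalized_instances" "Q \<bullet> X + c \<bullet> x < b"
    "\<And>y. y \<in> unit_box \<Longrightarrow> b < Q \<bullet> outer y + c \<bullet> y"
proof -
  obtain a b where a: "a \<bullet> (x, X) < b" "\<forall>z\<in>moment_hull + offdiag_nonpos. a \<bullet> z > b"
    using separating_hyperplane_closed_point[OF closed_convex_moment_hull_plus(2,1) out] by blast
  obtain c0 A where cA: "a = (c0, A)" by (cases a)
  define S where "S = (1/2) *\<^sub>R (A + transpose A)"
  have S_inner: "S \<bullet> Y = A \<bullet> Y" if "transpose Y = Y" for Y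
    by (simp add: S_def inner_left_distrib inner_transpose_left that)
  have S_sym: "transpose S = S"
    by (simp add: S_def transpose_def vec_eq_iff)
  have lower: "b < S \<bullet> Y + c0 \<bullet> y" if "(y, Y) \<in> moment_hull + offdiag_nonpos" for y Y
    using a(2) that S_inner[OF symmetric_of_moment_hull_plus[OF that]]
    by (force simp: cA inner_prod_def)
  have upper: "S \<bullet> X + c0 \<bullet> x < b"
    using a(1) S_inner[OF sym] by (simp add: cA inner_prod_def)
  have "0 \<le> S \<bullet> H" if H: "(0, H) \<in> offdiag_nonpos" for H
  proof -
    have "0 \<le> (c0, S) \<bullet> (0, H)"
    proof (rule cone_bounded_below_nonneg[where C = offdiag_nonpos and b = b])
      show "t *\<^sub>R (0, H) \<in> offdiag_nonpos" if "0 \<le> t" for t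
        using H that by (rule scaleR_offdiag_nonpos)
      fix z assume z: "z \<in> (offdiag_nonpos :: 'n pair_space set)"
      then have "(fst z, snd z) \<in> moment_hull + offdiag_nonpos"
        using set_plus_intro[OF zero_in_moment_hull z] by simp
      from lower[OF this] show "b < (c0, S) \<bullet> z" by (simp add: inner_prod_def)
    qed
    then show ?thesis by (simp add: inner_prod_def)
  qed
  then have S_offdiag: "S$i$j \<le> 0" if "i \<noteq> j" for i j
    using nonpos_if_inner_offdiag_nonpos_ge_0[OF S_sym] that by blast
  \<comment> \<open>Any positive upper bound for the entries of \<open>S\<close> and \<open>c0\<close> serves as the divisor.\<close>
  define N where "N = 1 + norm S + norm c0"
  have N: "0 < N" "norm S \<le> N" "norm c0 \<le> N"
    by (auto simp: N_def add_pos_nonneg)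
  have entry: "\<bar>S$i$j\<bar> \<le> N" for i j
    using component_le_norm_cart[of "S$i" j] Finite_Cartesian_Product.norm_nth_le[of S i] N(2) by linarith
  have "infnorm c0 \<le> N" using infnorm_le_norm[of c0] N(3) by linarith
  with N entry S_offdiag S_sym
  have "((1/N) *\<^sub>R S, (1/N) *\<^sub>R c0) \<in> normalized_instances"
    by (auto simp: normalized_instances_def symmetric_mat_def transpose_def vec_eq_iff
        infnorm_mul divide_le_eq divide_nonpos_pos)
  moreover have scale: "(1/N) *\<^sub>R S \<bullet> Y + (1/N) *\<^sub>R c0 \<bullet> y = (S \<bullet> Y + c0 \<bullet> y) / N" for Y y
    by (simp add: add_divide_distrib)
  have "(1/N) *\<^sub>R S \<bullet> X + (1/N) *\<^sub>R c0 \<bullet> x < b / N"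
    unfolding scale using upper N(1) by (simp add: divide_strict_right_mono)
  moreover have "b / N < (1/N) *\<^sub>R S \<bullet> outer y + (1/N) *\<^sub>R c0 \<bullet> y" if "y \<in> unit_box" for y
  proof -
    have "(0 :: 'n pair_space) \<in> offdiag_nonpos"
      by (simp add: offdiag_nonpos_eq zero_prod_def)
    from set_plus_intro[OF outer_in_moment_hull[OF that] this]
    have "b < S \<bullet> outer y + c0 \<bullet> y" by (intro lower) simp
    then show ?thesis
      unfolding scale using N(1) by (simp add: divide_strict_right_mono)
  qed
  ultimately show ?thesis by (rule that)
qed

section \<open>The characterization of tightness\<close>

theorem theorem5:
  fixes m :: nat
    and l :: "nat \<Rightarrow> 'n::{finite,linorder} pair_space \<Rightarrow> real"
  assumes "\<forall>j\<in>{1..m}. valid_cut (l j)"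
  shows "(\<forall>(Q, c)\<in>normalized_instances. tight_for (relaxation m l) Q c) \<longleftrightarrow>
         relaxation m l \<subseteq> moment_hull + offdiag_nonpos"
proof
  assume tight: "\<forall>(Q, c)\<in>normalized_instances. tight_for (relaxation m l) Q c"
  show "relaxation m l \<subseteq> moment_hull + offdiag_nonpos"
  proof (rule subrelI, rule ccontr)
    fix x X assume p: "(x, X) \<in> relaxation m l" and out: "(x, X) \<notin> moment_hull + offdiag_nonpos"
    have "transpose X = X"
      using p by (auto simp: relaxation_def sdp_set_def symmetric_mat_def)
    then obtain Q c b where inst: "(Q, c) \<in> normalized_instances"
      and less: "Q \<bullet> X + c \<bullet> x < b"
      and box: "\<And>y. y \<in> unit_box \<Longrightarrow> b < Q \<bullet> outer y + c \<bullet> y"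
      using separating_normalized_instance[OF _ out] by blast
    have "ereal b \<le> bcqp_value Q c"
      unfolding bcqp_value_def
      using box by (intro INF_greatest) (simp add: quadratic_form_eq_inner_outer less_imp_le)
    also have "bcqp_value Q c \<le> ereal (Q \<bullet> X + c \<bullet> x)"
      using tight inst p tight_for_iff[OF outer_in_relaxation[OF assms]] by fastforce
    finally show False using less by simp
  qed
next
  assume sub: "relaxation m l \<subseteq> moment_hull + offdiag_nonpos"
  have "bcqp_value Q c \<le> ereal (Q \<bullet> X + c \<bullet> x)"
    if inst: "(Q, c) \<in> normalized_instances" and p: "(x, X) \<in> relaxation m l" for Q c x X
  proof -
    obtain Y H where X: "X = Y + H" and Y: "(x, Y) \<in> moment_hull"
      and H: "(0, H) \<in> offdiag_nonpos"
      using subsetD[OF sub p] by (auto simp: set_plus_def offdiag_nonpos_def)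
    have "0 \<le> Q \<bullet> H"
      using inst H by (intro inner_offdiag_nonpos_ge_0) (auto simp: normalized_instances_def)
    then have "ereal (Q \<bullet> Y + c \<bullet> x) \<le> ereal (Q \<bullet> X + c \<bullet> x)"
      by (simp add: X inner_right_distrib)
    with bcqp_value_le_on_moment_hull[OF Y] show ?thesis by (rule order_trans)
  qed
  then show "\<forall>(Q, c)\<in>normalized_instances. tight_for (relaxation m l) Q c"
    using tight_for_iff[OF outer_in_relaxation[OF assms]] by auto
qed

end
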